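(* Let $\varepsilon>0$ be such that $\gamma+\varepsilon\in(0,1)$, let $w\in\mathbb{R}^{|\mathcal S||\mathcal A|}$ be any (entrywise) positive vector, and let $$v:=\left(\sum_{i=0}^\infty\left(\frac{1}{\gamma+\varepsilon}\right)^i A_{Q^*}^i\right)^T w\in\mathbb{R}^{|\mathcal S||\mathcal A|}.$$ Let $(Q_k)_{k\ge0}$ be the iterates of Q-value iteration started at $Q_0\in\mathbb{R}^{|\mathcal S||\mathcal A|}$, and suppose that $Q_0-Q^*\le0$ holds. Then $$(\gamma+\varepsilon)\,v^T(Q_k-Q^* )\le v^T(Q_{k+1}-Q^* )\le 0$$ for all $k\ge0$.
   Context: Consider a discounted Markov decision problem with finite state space $\mathcal S=\{1,\dots,|\mathcal S|\}$, finite action space $\mathcal A=\{1,\dots,|\mathcal A|\}$, transition probabilities $P(s'|s,a)$, deterministic reward function $r(s,a,s')$ with $|r(s,a,s')|\le 1$, and discount factor $\gamma\in[0,1)$. Put $R(s,a)=\sum_{s'}P(s'|s,a)\,r(s,a,s')$. For a deterministic policy $\pi:\mathcal S\to\mathcal A$, $Q^\pi(s,a)$ is the expected sum $\sum_{k\ge0}\gamma^k r(s_k,a_k,s_{k+1})$ when $s_0=s$, $a_0=a$ and $a_k=\pi(s_k)$ for $k\ge1$. The optimal Q-function is $Q^*=Q^{\pi^*}$ with $\pi^*$ an optimal deterministic policy; it satisfies the Bellman optimality equation $Q^*(s,a)=R(s,a)+\gamma\sum_{s'}P(s'|s,a)\max_{a'}Q^*(s',a')$, whose solution is unique. Q-functions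 are regarded as vectors in $\mathbb{R}^{|\mathcal S||\mathcal A|}$ indexed by state-action pairs. Inequalities between vectors are entrywise. For $Q\in\mathbb{R}^{|\mathcal S||\mathcal A|}$, the greedy policy is $\pi_Q(s)\in\arg\max_{a\in\mathcal A}Q(s,a)$ (some fixed selection), and $A_Q\in\mathbb{R}^{|\mathcal S||\mathcal A|\times|\mathcal S||\mathcal A|}$ is $\gamma$ times the state-action transition matrix under $\pi_Q$, i.e. its entry in row $(s,a)$ and column $(s',a')$ is $\gamma P(s'|s,a)$ if $a'=\pi_Q(s')$ and $0$ otherwise. Q-value iteration: given $Q_0\in\mathbb{R}^{|\mathcal S||\mathcal A|}$, for $k\ge0$, $Q_{k+1}(s,a)=R(s,a)+\gamma\sum_{s'\in\mathcal S}P(s'|s,a)\max_{a'\in\mathcal A}Q_k(s',a')$. *)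

theory Defs
  imports "HOL-Analysis.Analysis" "HOL-Probability.Probability"
begin

text \<open>
  The states and actions are the elements of finite types. The transition probability
  P(s'|s,a) is \<^term>\<open>pmf (P s a) s'\<close>, and Q-functions are vectors indexed by
  state-action pairs.
\<close>

type_synonym ('s, 'a) kernel = "'s \<Rightarrow> 'a \<Rightarrow> 's pmf"
type_synonym ('s, 'a) reward = "'s \<Rightarrow> 'a \<Rightarrow> 's \<Rightarrow> real"
type_synonym ('s, 'a) qvec = "real ^ ('s \<times> 'a)"

subsection \<open>Trajectories and Q-functions of deterministic policies\<close>

text \<open>
  A trajectory is a sequence of state-action pairs. Given the pairs at times \<open>0, \<dots>, i - 1\<close>,
  \<open>step_law P \<pi> x i\<close> is the conditional law of the pair at time \<open>i\<close> when the process starts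
  in the pair \<open>x\<close> and follows the policy \<open>\<pi>\<close> from time 1 on.
\<close>

definition step_law ::
  "('s, 'a) kernel \<Rightarrow> ('s \<Rightarrow> 'a) \<Rightarrow> 's \<times> 'a \<Rightarrow> nat \<Rightarrow> (nat \<Rightarrow> 's \<times> 'a) \<Rightarrow> ('s \<times> 'a) pmf" where
  "step_law P \<pi> x i \<omega> =
    (case i of
       0 \<Rightarrow> return_pmf x
     | Suc j \<Rightarrow> map_pmf (\<lambda>s'. (s', \<pi> s')) (P (fst (\<omega> j)) (snd (\<omega> j))))"

lemma Ionescu_Tulcea_step_law:
  fixes P :: "('s::finite, 'a::finite) kernel"
  shows "Ionescu_Tulcea (\<lambda>i \<omega>. measure_pmf (step_law P \<pi> x i \<omega>)) (\<lambda>_. count_space UNIV)"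
proof
  fix i
  show "(\<lambda>\<omega>. measure_pmf (step_law P \<pi> x i \<omega>))
      \<in> measurable (PiM {0..<i} (\<lambda>_. count_space UNIV)) (subprob_algebra (count_space UNIV))"
  proof (cases i)
    case 0
    then show ?thesis
      by (simp add: step_law_def measure_pmf_in_subprob_algebra)
  next
    case (Suc j)
    have "(\<lambda>\<omega>. \<omega> j) \<in> measurable (PiM {0..<i} (\<lambda>_. count_space UNIV)) (count_space (UNIV :: ('s \<times> 'a) set))"
      using Suc by (intro measurable_component_singleton) auto
    then have "(\<lambda>\<omega>. measure_pmf (map_pmf (\<lambda>s'. (s', \<pi> s')) (P (fst (\<omega> j)) (snd (\<omega> j)))))
      \<in> measurable (PiM {0..<i} (\<lambda>_. count_space UNIV)) (subprob_algebra (count_space UNIV))"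
      by (rule measurable_compose)
        (auto simp: measurable_def space_subprob_algebra measure_pmf.subprob_space_axioms)
    then show ?thesis
      by (simp add: step_law_def Suc)
  qed
qed

text \<open>The law of the whole trajectory, given by the Ionescu-Tulcea theorem.\<close>

definition traj_law ::
  "('s::finite, 'a::finite) kernel \<Rightarrow> ('s \<Rightarrow> 'a) \<Rightarrow> 's \<times> 'a \<Rightarrow> (nat \<Rightarrow> 's \<times> 'a) measure" where
  "traj_law P \<pi> x =
    projective_family.lim UNIV
      (Ionescu_Tulcea.CI (\<lambda>i \<omega>. measure_pmf (step_law P \<pi> x i \<omega>)) (\<lambda>_. count_space UNIV))
      (\<lambda>_. count_space UNIV)"

lemma sets_traj_law: "sets (traj_law P \<pi> x) = sets (PiM UNIV (\<lambda>_. count_space UNIV))"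
proof -
  interpret Ionescu_Tulcea "\<lambda>i \<omega>. measure_pmf (step_law P \<pi> x i \<omega>)" "\<lambda>_. count_space UNIV"
    by (rule Ionescu_Tulcea_step_law)
  show ?thesis
    by (simp add: traj_law_def)
qed

lemma distr_traj_law:
  fixes P :: "('s::finite, 'a::finite) kernel"
  assumes "finite J"
  shows "distr (traj_law P \<pi> x) (PiM J (\<lambda>_. count_space UNIV)) (\<lambda>\<omega>. restrict \<omega> J) =
    Ionescu_Tulcea.CI (\<lambda>i \<omega>. measure_pmf (step_law P \<pi> x i \<omega>)) (\<lambda>_. count_space UNIV) J"
proof -
  interpret Ionescu_Tulcea "\<lambda>i \<omega>. measure_pmf (step_law P \<pi> x i \<omega>)" "\<lambda>_. count_space UNIV"
    by (rule Ionescu_Tulcea_step_law)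
  show ?thesis
    unfolding traj_law_def using assms by (rule distr_lim)
qed

lemma prob_space_traj_law: "prob_space (traj_law P \<pi> x)"
proof -
  interpret Ionescu_Tulcea "\<lambda>i \<omega>. measure_pmf (step_law P \<pi> x i \<omega>)" "\<lambda>_. count_space UNIV"
    by (rule Ionescu_Tulcea_step_law)
  have "prob_space (distr (traj_law P \<pi> x) (PiM {} (\<lambda>_. count_space UNIV)) (\<lambda>\<omega>. restrict \<omega> {}))"
    by (simp only: distr_traj_law[OF finite.emptyI] PF.prob_space_P[OF finite.emptyI] subset_UNIV)
  then show ?thesis
    by (rule prob_space_distrD[rotated])
      (simp add: measurable_cong_sets[OF sets_traj_law refl] measurable_restrict_subset)
qed

definition discounted_return ::
  "('s, 'a) reward \<Rightarrow> real \<Rightarrow> (nat \<Rightarrow> 's \<times> 'a) \<Rightarrow> real" where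
  "discounted_return r \<gamma> \<omega> = (\<Sum>k. \<gamma> ^ k * r (fst (\<omega> k)) (snd (\<omega> k)) (fst (\<omega> (Suc k))))"

definition Q_policy ::
  "('s::finite, 'a::finite) kernel \<Rightarrow> ('s, 'a) reward \<Rightarrow> real \<Rightarrow> ('s \<Rightarrow> 'a) \<Rightarrow> ('s, 'a) qvec" where
  "Q_policy P r \<gamma> \<pi> = (\<chi> x. \<integral>\<omega>. discounted_return r \<gamma> \<omega> \<partial>traj_law P \<pi> x)"

text \<open>
  The expected return of \<open>\<pi>\<close> from state \<open>s\<close> is \<open>Q_policy P r \<gamma> \<pi> $ (s, \<pi> s)\<close>; an optimal policy
  maximizes it from every initial state, among all deterministic policies.
\<close>

definition optimal_policy ::
  "('s::finite, 'a::finite) kernel \<Rightarrow> ('s, 'a) reward \<Rightarrow> real \<Rightarrow> ('s \<Rightarrow> 'a) \<Rightarrow> bool" where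
  "optimal_policy P r \<gamma> \<pi> \<longleftrightarrow>
    (\<forall>\<pi>' s. Q_policy P r \<gamma> \<pi>' $ (s, \<pi>' s) \<le> Q_policy P r \<gamma> \<pi> $ (s, \<pi> s))"

subsection \<open>Q-value iteration\<close>

definition mean_reward :: "('s::finite, 'a) kernel \<Rightarrow> ('s, 'a) reward \<Rightarrow> 's \<Rightarrow> 'a \<Rightarrow> real" where
  "mean_reward P r s a = (\<Sum>s'\<in>UNIV. pmf (P s a) s' * r s a s')"

primrec Q_iter ::
  "('s::finite, 'a::finite) kernel \<Rightarrow> ('s, 'a) reward \<Rightarrow> real \<Rightarrow> ('s, 'a) qvec \<Rightarrow> nat \<Rightarrow> ('s, 'a) qvec" where
  "Q_iter P r \<gamma> Q0 0 = Q0"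
| "Q_iter P r \<gamma> Q0 (Suc k) =
    (\<chi> x. case x of (s, a) \<Rightarrow> mean_reward P r s a +
       \<gamma> * (\<Sum>s'\<in>UNIV. pmf (P s a) s' * (MAX a'\<in>UNIV. Q_iter P r \<gamma> Q0 k $ (s', a'))))"

subsection \<open>Greedy policies and the matrix of a greedy policy\<close>

text \<open>\<open>g Q\<close> plays the role of the greedy policy of \<open>Q\<close>; ties may be broken in any fixed way.\<close>

definition greedy_selection :: "(('s::finite, 'a::finite) qvec \<Rightarrow> 's \<Rightarrow> 'a) \<Rightarrow> bool" where
  "greedy_selection g \<longleftrightarrow> (\<forall>Q s. is_arg_max (\<lambda>a. Q $ (s, a)) (\<lambda>_. True) (g Q s))"

definition greedy_matrix ::
  "('s::finite, 'a::finite) kernel \<Rightarrow> real \<Rightarrow> (('s, 'a) qvec \<Rightarrow> 's \<Rightarrow> 'a) \<Rightarrow> ('s, 'a) qvec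
    \<Rightarrow> real ^ ('s \<times> 'a) ^ ('s \<times> 'a)" where
  "greedy_matrix P \<gamma> g Q =
    (\<chi> x y. case (x, y) of ((s, a), (s', a')) \<Rightarrow>
       if a' = g Q s' then \<gamma> * pmf (P s a) s' else 0)"

text \<open>The multiplication \<open>*\<close> and power of type \<^typ>\<open>real ^ 'n\<close> are entrywise, hence this definition.\<close>

primrec matrix_power :: "real ^ 'n ^ 'n \<Rightarrow> nat \<Rightarrow> real ^ 'n ^ 'n" where
  "matrix_power A 0 = mat 1"
| "matrix_power A (Suc i) = A ** matrix_power A i"

end

theory Submission
  imports Defs
begin

text \<open>
  Write \<open>A\<close> for the matrix of the greedy policy of \<open>Q\<^sup>*\<close>, \<open>\<beta> = \<gamma> + \<epsilon>\<close> and
  \<open>S = (\<Sum>i. \<beta>\<^sup>-\<^sup>i A\<^sup>i)\<close>. Since \<open>Q\<^sup>*\<close> solves the Bellman optimality equation,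
  the errors \<open>d\<^sub>k = Q\<^sub>k - Q\<^sup>*\<close> stay nonpositive by monotonicity, and
  \<open>A d\<^sub>k \<le> d\<^sub>k\<^sub>+\<^sub>1\<close> because the greedy action of \<open>Q\<^sup>*\<close> is suboptimal for \<open>Q\<^sub>k\<close>.
  The matrix \<open>S\<close> has nonnegative entries and \<open>S A = \<beta> (S - 1)\<close>, so pairing with
  \<open>v = S\<^sup>T w\<close> gives \<open>v \<bullet> d\<^sub>k\<^sub>+\<^sub>1 \<ge> v \<bullet> A d\<^sub>k = \<beta> (v \<bullet> d\<^sub>k) - \<beta> (w \<bullet> d\<^sub>k) \<ge> \<beta> (v \<bullet> d\<^sub>k)\<close>.

  The Bellman equation for a fixed policy comes from the two-step marginals of the trajectory
  law. An optimal policy is greedy for its own Q-function, as otherwise changing its action in a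
  single state would improve it.
\<close>

subsection \<open>Sums of powers of a nonnegative matrix\<close>

lemma sums_vec_componentwise:
  fixes f :: "nat \<Rightarrow> ('b::real_normed_vector) ^ 'n::finite"
  assumes "\<And>i. (\<lambda>n. f n $ i) sums (l $ i)"
  shows "f sums l"
  using assms unfolding sums_def by (intro vec_tendstoI) simp

lemma summable_vec_componentwise:
  fixes f :: "nat \<Rightarrow> ('b::real_normed_vector) ^ 'n::finite"
  assumes "\<And>i. summable (\<lambda>n. f n $ i)"
  shows "summable f"
proof -
  have "f sums (\<chi> i. \<Sum>n. f n $ i)"
    using assms by (intro sums_vec_componentwise) (simp add: summable_sums)
  then show ?thesis
    by (rule sums_summable)
qed

lemma matrix_power_entry_nonneg:
  fixes A :: "real ^ 'n::finite ^ 'n"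
  assumes "\<And>x y. 0 \<le> A $ x $ y"
  shows "0 \<le> matrix_power A i $ x $ y"
proof (induction i arbitrary: x y)
  case 0
  then show ?case by (simp add: mat_def)
next
  case (Suc i)
  then show ?case
    using assms by (simp add: matrix_matrix_mult_def sum_nonneg)
qed

text \<open>A row of \<open>A ** M\<close> combines the rows of \<open>M\<close> with weights from a
  row of \<open>A\<close>. As the weights are nonnegative, each factor costs at most one
  \<open>\<gamma>\<close>.\<close>

lemma matrix_power_row_sum_le:
  fixes A :: "real ^ 'n::finite ^ 'n"
  assumes nonneg: "\<And>x y. 0 \<le> A $ x $ y"
    and row_sum: "\<And>x. (\<Sum>y\<in>UNIV. A $ x $ y) \<le> \<gamma>"
  shows "(\<Sum>y\<in>UNIV. matrix_power A i $ x $ y) \<le> \<gamma> ^ i"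
proof (induction i arbitrary: x)
  case 0
  then show ?case by (simp add: mat_def)
next
  case (Suc i)
  have "0 \<le> (\<Sum>y\<in>UNIV. A $ x $ y)"
    using nonneg by (intro sum_nonneg)
  then have "0 \<le> \<gamma>"
    using row_sum[of x] by linarith
  have "(\<Sum>y\<in>UNIV. matrix_power A (Suc i) $ x $ y)
      = (\<Sum>z\<in>UNIV. A $ x $ z * (\<Sum>y\<in>UNIV. matrix_power A i $ z $ y))"
    unfolding matrix_power.simps matrix_matrix_mult_def
    by (simp add: sum_distrib_left) (rule sum.swap)
  also have "\<dots> \<le> (\<Sum>z\<in>UNIV. A $ x $ z * \<gamma> ^ i)"
    using Suc nonneg by (intro sum_mono mult_left_mono)
  also have "\<dots> \<le> \<gamma> * \<gamma> ^ i"
    using row_sum[of x] \<open>0 \<le> \<gamma>\<close> by (simp flip: sum_distrib_right add: mult_right_mono)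
  finally show ?case by simp
qed

text \<open>\<open>matrix_power\<close> adds new factors on the left; the index shift of the series
  needs the extra factor on the right.\<close>

lemma matrix_power_mult_vec_commute:
  fixes A :: "real ^ 'n::finite ^ 'n"
  shows "matrix_power A i *v (A *v d) = matrix_power A (Suc i) *v d"
  by (induction i) (simp_all flip: matrix_vector_mul_assoc)

text \<open>This isolates what is used of the greedy matrix. Later \<open>\<beta>\<close> is
  \<open>\<gamma> + \<epsilon>\<close>, and the gap \<open>less\<close> provides a convergent
  geometric majorant.\<close>

locale discounted_matrix =
  fixes A :: "real ^ 'n::finite ^ 'n" and \<gamma> \<beta> :: real
  assumes nonneg: "0 \<le> A $ x $ y"
    and row_sum: "(\<Sum>y\<in>UNIV. A $ x $ y) \<le> \<gamma>"
    and less: "\<gamma> < \<beta>"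
begin

lemma discount_nonneg: "0 \<le> \<gamma>"
proof -
  \<comment> \<open>Any row serves, since the index type is inhabited.\<close>
  have "0 \<le> (\<Sum>y\<in>UNIV. A $ undefined $ y)"
    using nonneg by (intro sum_nonneg)
  then show ?thesis
    using row_sum[of undefined] by linarith
qed

lemma weight_pos: "0 < \<beta>"
  using discount_nonneg less by simp

definition neumann_sum :: "real ^ 'n ^ 'n" where
  "neumann_sum = (\<Sum>i. (1 / \<beta>) ^ i *\<^sub>R matrix_power A i)"

text \<open>A nonnegative entry is at most its row sum, so each entry of the series is dominated by
  powers of \<open>\<gamma> / \<beta> < 1\<close>.\<close>

lemma summable_neumann: "summable (\<lambda>i. (1 / \<beta>) ^ i *\<^sub>R matrix_power A i)"
proof (intro summable_vec_componentwise)
  fix x y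
  have "norm (((1 / \<beta>) ^ i *\<^sub>R matrix_power A i) $ x $ y) \<le> (\<gamma> / \<beta>) ^ i" for i
  proof -
    have "matrix_power A i $ x $ y \<le> (\<Sum>z\<in>UNIV. matrix_power A i $ x $ z)"
      by (intro member_le_sum matrix_power_entry_nonneg nonneg) auto
    also have "\<dots> \<le> \<gamma> ^ i"
      by (intro matrix_power_row_sum_le nonneg row_sum)
    finally show ?thesis
      using weight_pos matrix_power_entry_nonneg[of A i x y, OF nonneg]
      by (simp add: power_divide abs_mult divide_simps)
  qed
  moreover have "summable (\<lambda>i. (\<gamma> / \<beta>) ^ i)"
    using less discount_nonneg by (intro summable_geometric) simp
  ultimately show "summable (\<lambda>i. ((1 / \<beta>) ^ i *\<^sub>R matrix_power A i) $ x $ y)"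
    by (rule summable_comparison_test'[where N = 0, rotated])
qed

text \<open>Applying a matrix to a fixed vector is linear in the matrix, hence bounded in finite
  dimension, so it passes through the series.\<close>

lemma neumann_sum_mult_sums:
  "(\<lambda>i. (1 / \<beta>) ^ i *\<^sub>R (matrix_power A i *v d)) sums (neumann_sum *v d)"
proof -
  have "linear (\<lambda>M :: real ^ 'n ^ 'n. M *v d)"
    by (intro linearI) (simp_all add: matrix_vector_mult_add_rdistrib scaleR_matrix_vector_assoc)
  then have "bounded_linear (\<lambda>M :: real ^ 'n ^ 'n. M *v d)"
    by (simp add: linear_conv_bounded_linear)
  from bounded_linear.sums[OF this summable_sums[OF summable_neumann]] show ?thesis
    by (simp add: neumann_sum_def scaleR_matrix_vector_assoc)
qed

text \<open>Multiplying by \<open>A\<close> shifts the series by one index: the zeroth term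
  \<open>d\<close> is lost and a factor \<open>\<beta>\<close> comes out. Equivalently,
  \<open>neumann_sum\<close> is a left inverse of
  \<open>mat 1 - (1 / \<beta>) *\<^sub>R A\<close>.\<close>

lemma neumann_sum_shift: "neumann_sum *v (A *v d) = \<beta> *\<^sub>R (neumann_sum *v d - d)"
proof -
  have "(\<lambda>i. (1 / \<beta>) ^ Suc i *\<^sub>R (matrix_power A (Suc i) *v d)) sums (neumann_sum *v d - d)"
    using neumann_sum_mult_sums[of d]
    by (subst sums_Suc_iff) (simp add: matrix_vector_mul_lid)
  from sums_scaleR_right[OF this, of \<beta>]
  have "(\<lambda>i. (1 / \<beta>) ^ i *\<^sub>R (matrix_power A i *v (A *v d))) sums (\<beta> *\<^sub>R (neumann_sum *v d - d))"
    using weight_pos by (simp add: matrix_power_mult_vec_commute del: matrix_power.simps)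
  then show ?thesis
    using neumann_sum_mult_sums sums_unique2 by blast
qed

lemma neumann_sum_mult_nonneg:
  assumes "0 \<le> d"
  shows "0 \<le> neumann_sum *v d"
  unfolding less_eq_vec_def
proof
  fix x
  have "0 \<le> (matrix_power A i *v d) $ x" for i
    using assms matrix_power_entry_nonneg[of A, OF nonneg]
    by (auto simp: matrix_vector_mult_def less_eq_vec_def intro!: sum_nonneg)
  then have "0 \<le> ((1 / \<beta>) ^ i *\<^sub>R (matrix_power A i *v d)) $ x" for i
    using weight_pos by simp
  moreover have "(\<lambda>i. ((1 / \<beta>) ^ i *\<^sub>R (matrix_power A i *v d)) $ x) sums (neumann_sum *v d) $ x"
    by (rule bounded_linear.sums[OF bounded_linear_vec_nth neumann_sum_mult_sums])
  ultimately have "0 \<le> (neumann_sum *v d) $ x"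
    by (rule sums_le[OF _ sums_zero])
  then show "0 $ x \<le> (neumann_sum *v d) $ x"
    by simp
qed

end

subsection \<open>The Bellman equation of a policy\<close>

text \<open>The Markov operator of the chain of state-action pairs. The policy acts only at the
  successor; the current pair keeps its own action.\<close>

definition policy_step :: "('s::finite, 'a) kernel \<Rightarrow> ('s \<Rightarrow> 'a) \<Rightarrow> ('s \<times> 'a \<Rightarrow> real) \<Rightarrow> 's \<times> 'a \<Rightarrow> real" where
  "policy_step P \<pi> f x = (\<Sum>s'\<in>UNIV. pmf (P (fst x) (snd x)) s' * f (s', \<pi> s'))"

section \<open>Marginals of the trajectory law\<close>

lemma measurable_coordinate:
  "k \<in> J \<Longrightarrow> (\<lambda>\<omega>. \<omega> k) \<in> measurable (PiM J (\<lambda>_. count_space UNIV)) (count_space UNIV)"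
  using measurable_component_singleton[of k J "\<lambda>_. count_space UNIV"] by simp

text \<open>Splitting over the countably many values of \<open>\<omega> j\<close> leaves functions
  of one coordinate.\<close>

lemma measurable_two_coordinates:
  fixes F :: "'b::countable \<Rightarrow> 'b \<Rightarrow> real"
  assumes "j \<in> J" "k \<in> J"
  shows "(\<lambda>\<omega>. F (\<omega> j) (\<omega> k)) \<in> borel_measurable (PiM J (\<lambda>_. count_space UNIV))"
proof (rule measurable_compose_countable[where g = "\<lambda>\<omega>. \<omega> j" and f = "\<lambda>y \<omega>. F y (\<omega> k)"])
  fix y
  show "(\<lambda>\<omega>. F y (\<omega> k)) \<in> borel_measurable (PiM J (\<lambda>_. count_space UNIV))"
    using measurable_compose[OF measurable_coordinate[OF assms(2)], of "F y" borel] by simp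
qed (rule measurable_coordinate[OF assms(1)])

context
  fixes P :: "('s::finite, 'a::finite) kernel" and \<pi> :: "'s \<Rightarrow> 'a" and x :: "'s \<times> 'a"
begin

interpretation IT: Ionescu_Tulcea "\<lambda>i \<omega>. measure_pmf (step_law P \<pi> x i \<omega>)" "\<lambda>_. count_space UNIV"
  by (rule Ionescu_Tulcea_step_law)

text \<open>Replaces the projective limit by a finite composition of kernels. The second assumption
  says that \<open>h\<close> reads only the first \<open>n\<close> coordinates.\<close>

lemma integral_traj_law_prefix:
  fixes h :: "(nat \<Rightarrow> 's \<times> 'a) \<Rightarrow> real"
  assumes h: "h \<in> borel_measurable (PiM {0..<n} (\<lambda>_. count_space UNIV))"
    and restrict: "\<And>\<omega>. h (restrict \<omega> {0..<n}) = h \<omega>"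
  shows "(\<integral>\<omega>. h \<omega> \<partial>traj_law P \<pi> x) = (\<integral>\<omega>. h \<omega> \<partial>IT.C 0 n (\<lambda>_. undefined))"
proof -
  \<comment> \<open>For an initial segment of times, the marginal \<open>IT.CI\<close> is therefore
    the kernel composition itself.\<close>
  have up_to: "IT.up_to {0..<n} = n"
    using IT.up_to[of "{0..<n}"] IT.up_to_iff[of "{0..<n}" n] by (auto intro: antisym)
  have C: "IT.CI {0..<n} = IT.C 0 n (\<lambda>_. undefined)"
    using IT.distr_C[of n n "\<lambda>_. undefined" 0]
    by (simp add: IT.CI_def up_to)
  have "(\<lambda>\<omega>. restrict \<omega> {0..<n}) \<in> measurable (traj_law P \<pi> x) (PiM {0..<n} (\<lambda>_. count_space UNIV))"
    by (simp add: measurable_cong_sets[OF sets_traj_law refl] measurable_restrict_subset)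
  from integral_distr[OF this h] show ?thesis
    by (simp add: distr_traj_law C restrict)
qed

text \<open>Integrates out the last coordinate first, since the longer composition is a monadic bind
  of the shorter one with the next kernel. The bound \<open>B\<close> justifies the iterated
  integral.\<close>

lemma integral_prefix_Suc:
  fixes h :: "(nat \<Rightarrow> 's \<times> 'a) \<Rightarrow> real"
  assumes h: "h \<in> borel_measurable (PiM {0..<Suc n} (\<lambda>_. count_space UNIV))"
    and bound: "\<And>\<omega>. \<bar>h \<omega>\<bar> \<le> B"
  shows "(\<integral>\<omega>. h \<omega> \<partial>IT.C 0 (Suc n) (\<lambda>_. undefined))
    = (\<integral>\<omega>. (\<integral>y. h (fun_upd \<omega> n y) \<partial>step_law P \<pi> x n \<omega>) \<partial>IT.C 0 n (\<lambda>_. undefined))"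
proof -
  let ?C = "IT.C 0 n (\<lambda>_. undefined)"
  have undef: "(\<lambda>_. undefined) \<in> space (PiM {0..<0::nat} (\<lambda>_. count_space UNIV))"
    by (simp add: space_PiM)
  interpret C: prob_space ?C
    using undef by (rule IT.prob_space_C)
  have space: "space ?C = space (PiM {0..<n} (\<lambda>_. count_space UNIV))"
    using IT.space_C[OF undef, of n] by simp
  have eP: "IT.eP n \<in> measurable ?C (subprob_algebra (PiM {0..<Suc n} (\<lambda>_. count_space UNIV)))"
    using IT.measurable_eP[of n]
    by (simp add: measurable_cong_sets[OF IT.sets_C[OF undef, of n, unfolded add_0] refl])
  have "(\<integral>\<omega>. h \<omega> \<partial>IT.C 0 (Suc n) (\<lambda>_. undefined)) = (\<integral>\<omega>. (\<integral>\<omega>'. h \<omega>' \<partial>IT.eP n \<omega>) \<partial>?C)"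
    unfolding IT.C.simps add_0
  proof (rule integral_bind[OF h _ eP])
    show "AE \<omega> in ?C. emeasure (IT.eP n \<omega>) (space (IT.eP n \<omega>)) \<le> ennreal 1"
      using IT.prob_space_eP[of _ n] space
      by (intro AE_I2) (auto simp: prob_space.emeasure_space_1)
  qed (use bound C.finite_measure_axioms in auto)
  also have "\<dots> = (\<integral>\<omega>. (\<integral>y. h (fun_upd \<omega> n y) \<partial>step_law P \<pi> x n \<omega>) \<partial>?C)"
  proof (rule Bochner_Integration.integral_cong[OF refl])
    fix \<omega> assume "\<omega> \<in> space ?C"
    then have "fun_upd \<omega> n \<in> measurable (measure_pmf (step_law P \<pi> x n \<omega>)) (PiM {0..<Suc n} (\<lambda>_. count_space UNIV))"
      unfolding space by (intro measurable_fun_upd[where J = "{0..<n}"]) auto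
    from integral_distr[OF this h]
    show "(\<integral>\<omega>'. h \<omega>' \<partial>IT.eP n \<omega>) = (\<integral>y. h (fun_upd \<omega> n y) \<partial>step_law P \<pi> x n \<omega>)"
      by (simp add: IT.eP_def)
  qed
  finally show ?thesis .
qed

lemma integral_step_law_Suc:
  fixes f :: "'s \<times> 'a \<Rightarrow> real"
  shows "(\<integral>y. f y \<partial>step_law P \<pi> x (Suc n) \<omega>) = policy_step P \<pi> f (\<omega> n)"
  by (simp add: step_law_def policy_step_def integral_measure_pmf[where A = UNIV])

lemma integral_prefix_pair:
  fixes F :: "'s \<times> 'a \<Rightarrow> 's \<times> 'a \<Rightarrow> real"
  shows "(\<integral>\<omega>. F (\<omega> n) (\<omega> (Suc n)) \<partial>IT.C 0 (Suc (Suc n)) (\<lambda>_. undefined))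
    = (\<integral>\<omega>. policy_step P \<pi> (F (\<omega> n)) (\<omega> n) \<partial>IT.C 0 (Suc n) (\<lambda>_. undefined))"
proof -
  \<comment> \<open>On a finite type the sum of all absolute values is a bound, crude but
    sufficient.\<close>
  have bound: "\<bar>F y z\<bar> \<le> (\<Sum>y\<in>UNIV. \<Sum>z\<in>UNIV. \<bar>F y z\<bar>)" for y z
  proof -
    have "\<bar>F y z\<bar> \<le> (\<Sum>z\<in>UNIV. \<bar>F y z\<bar>)"
      by (intro member_le_sum) auto
    also have "\<dots> \<le> (\<Sum>y\<in>UNIV. \<Sum>z\<in>UNIV. \<bar>F y z\<bar>)"
      by (rule member_le_sum[where f = "\<lambda>y. \<Sum>z\<in>UNIV. \<bar>F y z\<bar>"]) (auto intro: sum_nonneg)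
    finally show ?thesis .
  qed
  show ?thesis
    using integral_prefix_Suc[of "\<lambda>\<omega>. F (\<omega> n) (\<omega> (Suc n))" "Suc n" "\<Sum>y\<in>UNIV. \<Sum>z\<in>UNIV. \<bar>F y z\<bar>"]
    by (simp add: bound measurable_two_coordinates integral_step_law_Suc)
qed

text \<open>Peeling off the last time replaces \<open>f\<close> by
  \<open>policy_step P \<pi> f\<close>, so \<open>f\<close> must vary in the induction. At time 0
  the law is the point mass at \<open>x\<close>.\<close>

lemma integral_prefix_last:
  fixes f :: "'s \<times> 'a \<Rightarrow> real"
  shows "(\<integral>\<omega>. f (\<omega> n) \<partial>IT.C 0 (Suc n) (\<lambda>_. undefined)) = (policy_step P \<pi> ^^ n) f x"
proof (induction n arbitrary: f)
  case 0
  have bound: "\<bar>f y\<bar> \<le> (\<Sum>y\<in>UNIV. \<bar>f y\<bar>)" for y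
    by (intro member_le_sum) auto
  have undef: "(\<lambda>_. undefined) \<in> space (PiM {0..<0::nat} (\<lambda>_. count_space UNIV))"
    by (simp add: space_PiM)
  interpret C: prob_space "IT.C 0 0 (\<lambda>_. undefined)"
    using undef by (rule IT.prob_space_C)
  have "(\<integral>\<omega>. f (\<omega> 0) \<partial>IT.C 0 (Suc 0) (\<lambda>_. undefined)) = (\<integral>\<omega>. f x \<partial>IT.C 0 0 (\<lambda>_. undefined))"
    using integral_prefix_Suc[of "\<lambda>\<omega>. f (\<omega> 0)" 0 "\<Sum>y\<in>UNIV. \<bar>f y\<bar>"] bound
      measurable_two_coordinates[of 0 "{0..<Suc 0}" 0 "\<lambda>y _. f y"]
    by (simp add: step_law_def integral_return del: IT.C.simps)
  also have "\<dots> = f x"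
    using C.prob_space by simp
  finally show ?case by simp
next
  case (Suc n)
  have "(\<integral>\<omega>. f (\<omega> (Suc n)) \<partial>IT.C 0 (Suc (Suc n)) (\<lambda>_. undefined))
      = (\<integral>\<omega>. policy_step P \<pi> f (\<omega> n) \<partial>IT.C 0 (Suc n) (\<lambda>_. undefined))"
    by (rule integral_prefix_pair)
  also have "\<dots> = (policy_step P \<pi> ^^ n) (policy_step P \<pi> f) x"
    by (rule Suc)
  finally show ?case
    by (simp add: funpow_swap1)
qed

text \<open>A reward depends on two consecutive pairs, so this is the marginal that the expected
  return needs.\<close>

lemma integral_traj_law_transition:
  fixes F :: "'s \<times> 'a \<Rightarrow> 's \<times> 'a \<Rightarrow> real"
  shows "(\<integral>\<omega>. F (\<omega> n) (\<omega> (Suc n)) \<partial>traj_law P \<pi> x)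
    = (policy_step P \<pi> ^^ n) (\<lambda>y. policy_step P \<pi> (F y) y) x"
  using integral_traj_law_prefix[of "\<lambda>\<omega>. F (\<omega> n) (\<omega> (Suc n))" "Suc (Suc n)"]
    integral_prefix_pair[of n F] integral_prefix_last[of n "\<lambda>y. policy_step P \<pi> (F y) y"]
  by (simp add: measurable_two_coordinates del: IT.C.simps)

end

section \<open>Expected discounted return as a series\<close>

lemma Q_policy_sums:
  fixes P :: "('s::finite, 'a::finite) kernel"
  assumes reward_bound: "\<And>s a s'. \<bar>r s a s'\<bar> \<le> 1"
    and discount: "0 \<le> \<gamma>" "\<gamma> < 1"
  shows "(\<lambda>k. \<gamma> ^ k * (policy_step P \<pi> ^^ k) (\<lambda>y. mean_reward P r (fst y) (snd y)) x)
    sums (Q_policy P r \<gamma> \<pi> $ x)"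
proof -
  interpret prob_space "traj_law P \<pi> x"
    by (rule prob_space_traj_law)
  define c where "c k \<omega> = \<gamma> ^ k * r (fst (\<omega> k)) (snd (\<omega> k)) (fst (\<omega> (Suc k)))"
    for k and \<omega> :: "nat \<Rightarrow> 's \<times> 'a"
  have bound: "norm (c k \<omega>) \<le> \<gamma> ^ k" for k \<omega>
    using reward_bound discount by (simp add: c_def abs_mult mult_left_le)
  have measurable: "c k \<in> borel_measurable (traj_law P \<pi> x)" for k
    unfolding c_def measurable_cong_sets[OF sets_traj_law refl]
    by (rule measurable_two_coordinates[where F = "\<lambda>y z. \<gamma> ^ k * r (fst y) (snd y) (fst z)"]) auto
  have integrable: "integrable (traj_law P \<pi> x) (c k)" for k
    using bound measurable by (intro integrable_const_bound[where B = "\<gamma> ^ k"]) auto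
  have geometric: "summable (\<lambda>k. \<gamma> ^ k)"
    using discount by (simp add: summable_geometric)
  have summable: "summable (\<lambda>k. norm (c k \<omega>))" for \<omega>
    using bound by (intro summable_comparison_test'[OF geometric, of 0]) simp
  have "(\<integral>\<omega>. norm (c k \<omega>) \<partial>traj_law P \<pi> x) \<le> (\<integral>\<omega>. \<gamma> ^ k \<partial>traj_law P \<pi> x)" for k
    using bound integrable by (intro integral_mono) auto
  then have norm_integral: "(\<integral>\<omega>. norm (c k \<omega>) \<partial>traj_law P \<pi> x) \<le> \<gamma> ^ k" for k
    by (simp add: prob_space)
  have "summable (\<lambda>k. \<integral>\<omega>. norm (c k \<omega>) \<partial>traj_law P \<pi> x)"
    using norm_integral by (intro summable_comparison_test'[OF geometric, of 0]) simp
  \<comment> \<open>Expectation and sum are exchanged thanks to the uniform bounds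
    \<open>\<gamma> ^ k\<close>.\<close>
  then have "(\<lambda>k. \<integral>\<omega>. c k \<omega> \<partial>traj_law P \<pi> x) sums (\<integral>\<omega>. (\<Sum>k. c k \<omega>) \<partial>traj_law P \<pi> x)"
    using summable by (intro sums_integral integrable) auto
  moreover have "(\<integral>\<omega>. c k \<omega> \<partial>traj_law P \<pi> x)
      = \<gamma> ^ k * (policy_step P \<pi> ^^ k) (\<lambda>y. mean_reward P r (fst y) (snd y)) x" for k
    \<comment> \<open>This \<open>F\<close> reads only the state of the successor, so averaging it
      over one step gives \<open>mean_reward\<close>.\<close>
    using integral_traj_law_transition[where F = "\<lambda>y z. r (fst y) (snd y) (fst z)" and n = k and P = P and \<pi> = \<pi> and x = x]
    by (simp add: c_def policy_step_def[of P \<pi> "\<lambda>z. r _ _ (fst z)"] mean_reward_def)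
  ultimately show ?thesis
    by (simp only: Q_policy_def discounted_return_def c_def vec_lambda_beta)
qed

text \<open>The zeroth term of the series is the mean reward; the rest is \<open>\<gamma>\<close>
  times one policy step applied to the whole series.\<close>

lemma Q_policy_Bellman:
  fixes P :: "('s::finite, 'a::finite) kernel"
  assumes reward_bound: "\<And>s a s'. \<bar>r s a s'\<bar> \<le> 1"
    and discount: "0 \<le> \<gamma>" "\<gamma> < 1"
  shows "Q_policy P r \<gamma> \<pi> $ (s, a) = mean_reward P r s a
    + \<gamma> * (\<Sum>s'\<in>UNIV. pmf (P s a) s' * Q_policy P r \<gamma> \<pi> $ (s', \<pi> s'))"
proof -
  define u where "u k = (policy_step P \<pi> ^^ k) (\<lambda>y. mean_reward P r (fst y) (snd y))" for k
  have u: "(\<lambda>k. \<gamma> ^ k * u k y) sums (Q_policy P r \<gamma> \<pi> $ y)" for y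
    unfolding u_def using assms by (rule Q_policy_sums)
  have "(\<lambda>k. \<gamma> * (\<Sum>s'\<in>UNIV. pmf (P s a) s' * (\<gamma> ^ k * u k (s', \<pi> s'))))
      sums (\<gamma> * (\<Sum>s'\<in>UNIV. pmf (P s a) s' * Q_policy P r \<gamma> \<pi> $ (s', \<pi> s')))"
    by (intro sums_mult sums_sum u)
  moreover have "\<gamma> * (\<Sum>s'\<in>UNIV. pmf (P s a) s' * (\<gamma> ^ k * u k (s', \<pi> s'))) = \<gamma> ^ Suc k * u (Suc k) (s, a)" for k
    by (simp add: u_def policy_step_def sum_distrib_left mult_ac)
  ultimately have "(\<lambda>k. \<gamma> ^ k * u k (s, a))
      sums (\<gamma> * (\<Sum>s'\<in>UNIV. pmf (P s a) s' * Q_policy P r \<gamma> \<pi> $ (s', \<pi> s')) + \<gamma> ^ 0 * u 0 (s, a))"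
    using sums_Suc[of "\<lambda>k. \<gamma> ^ k * u k (s, a)"] by (simp only:)
  with u[of "(s, a)"] have "Q_policy P r \<gamma> \<pi> $ (s, a)
      = \<gamma> * (\<Sum>s'\<in>UNIV. pmf (P s a) s' * Q_policy P r \<gamma> \<pi> $ (s', \<pi> s')) + \<gamma> ^ 0 * u 0 (s, a)"
    by (rule sums_unique2)
  then show ?thesis
    by (simp add: u_def)
qed

subsection \<open>The Bellman optimality equation\<close>

text \<open>Policy improvement by a minimum principle: switching to a better action at
  \<open>s\<close> lowers the value in no state and raises it strictly at \<open>s\<close>, against
  optimality.\<close>

lemma optimal_policy_greedy:
  fixes P :: "('s::finite, 'a::finite) kernel"
  assumes reward_bound: "\<And>s a s'. \<bar>r s a s'\<bar> \<le> 1"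
    and discount: "0 \<le> \<gamma>" "\<gamma> < 1"
    and optimal: "optimal_policy P r \<gamma> \<pi>"
  shows "Q_policy P r \<gamma> \<pi> $ (s, a) \<le> Q_policy P r \<gamma> \<pi> $ (s, \<pi> s)"
proof (rule ccontr)
  assume improvement: "\<not> ?thesis"
  define \<pi>' where "\<pi>' = fun_upd \<pi> s a"
  let ?Q = "\<lambda>\<pi>. Q_policy P r \<gamma> \<pi>"
  define \<Delta> where "\<Delta> t = ?Q \<pi>' $ (t, \<pi>' t) - ?Q \<pi> $ (t, \<pi> t)" for t
  \<comment> \<open>Both Bellman equations are taken at the same action \<open>\<pi>' t\<close>, so
    the rewards cancel. The last bracket is the one-step gain, positive at \<open>s\<close> and zero
    elsewhere.\<close>
  have \<Delta>: "\<Delta> t = \<gamma> * (\<Sum>s'\<in>UNIV. pmf (P t (\<pi>' t)) s' * \<Delta> s') + (?Q \<pi> $ (t, \<pi>' t) - ?Q \<pi> $ (t, \<pi> t))" for t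
    using Q_policy_Bellman[where r = r and P = P and \<pi> = \<pi>' and s = t and a = "\<pi>' t", OF reward_bound discount]
      Q_policy_Bellman[where r = r and P = P and \<pi> = \<pi> and s = t and a = "\<pi>' t", OF reward_bound discount]
    by (simp add: \<Delta>_def right_diff_distrib sum_subtractf)
  have gain: "?Q \<pi> $ (t, \<pi> t) \<le> ?Q \<pi> $ (t, \<pi>' t)" for t
    using improvement by (simp add: \<pi>'_def)
  define m where "m = (MIN t. \<Delta> t)"
  have "m \<le> \<Delta> t" for t
    by (simp add: m_def)
  have avg: "m \<le> (\<Sum>s'\<in>UNIV. pmf (P t b) s' * \<Delta> s')" for t b
  proof -
    have "m = (\<Sum>s'\<in>UNIV. pmf (P t b) s' * m)"
      by (simp flip: sum_distrib_right add: sum_pmf_eq_1)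
    also have "\<dots> \<le> (\<Sum>s'\<in>UNIV. pmf (P t b) s' * \<Delta> s')"
      using \<open>\<And>t. m \<le> \<Delta> t\<close> by (intro sum_mono mult_left_mono) auto
    finally show ?thesis .
  qed
  have "m \<in> range \<Delta>"
    unfolding m_def by (intro Min_in) auto
  then obtain t where "m = \<Delta> t" by blast
  \<comment> \<open>At a state where \<open>\<Delta>\<close> is minimal, its average over successors
    is at least \<open>m\<close> and the gain is nonnegative.\<close>
  with \<Delta>[of t] gain[of t] mult_left_mono[OF avg discount(1), of t "\<pi>' t"] have "\<gamma> * m \<le> m"
    by linarith
  then have "0 \<le> (1 - \<gamma>) * m"
    by (simp add: algebra_simps)
  then have "0 \<le> m"
    using discount by (simp add: zero_le_mult_iff)
  then have "0 \<le> \<gamma> * (\<Sum>s'\<in>UNIV. pmf (P s (\<pi>' s)) s' * \<Delta> s')"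
    using avg[of s "\<pi>' s"] discount by (intro mult_nonneg_nonneg) auto
  then have "0 < \<Delta> s"
    using \<Delta>[of s] improvement by (simp add: \<pi>'_def)
  moreover have "\<Delta> s \<le> 0"
    using optimal by (simp add: optimal_policy_def \<Delta>_def)
  ultimately show False by simp
qed

lemma greedy_selection_MAX:
  assumes "greedy_selection g"
  shows "(MAX a. Q $ (s, a)) = Q $ (s, g Q s)"
  using assms unfolding greedy_selection_def is_arg_max_def
  by (intro Max_eqI) (auto simp: not_less)

lemma optimal_policy_Bellman:
  fixes P :: "('s::finite, 'a::finite) kernel"
  assumes reward_bound: "\<And>s a s'. \<bar>r s a s'\<bar> \<le> 1"
    and discount: "0 \<le> \<gamma>" "\<gamma> < 1"
    and optimal: "optimal_policy P r \<gamma> \<pi>"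
  shows "Q_policy P r \<gamma> \<pi> $ (s, a) = mean_reward P r s a
    + \<gamma> * (\<Sum>s'\<in>UNIV. pmf (P s a) s' * (MAX a'. Q_policy P r \<gamma> \<pi> $ (s', a')))"
proof -
  have "(MAX a'. Q_policy P r \<gamma> \<pi> $ (s', a')) = Q_policy P r \<gamma> \<pi> $ (s', \<pi> s')" for s'
    using optimal_policy_greedy[where r = r, OF assms] by (intro Max_eqI) auto
  then show ?thesis
    using Q_policy_Bellman[where r = r and P = P and \<pi> = \<pi> and s = s and a = a, OF reward_bound discount] by simp
qed

subsection \<open>The error of Q-value iteration\<close>

lemma greedy_matrix_mult_vec:
  "(greedy_matrix P \<gamma> g Q *v d) $ (s, a) = \<gamma> * (\<Sum>s'\<in>UNIV. pmf (P s a) s' * d $ (s', g Q s'))"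
proof -
  have "(greedy_matrix P \<gamma> g Q *v d) $ (s, a)
      = (\<Sum>s'\<in>UNIV. \<Sum>a'\<in>UNIV. (if a' = g Q s' then \<gamma> * pmf (P s a) s' else 0) * d $ (s', a'))"
    by (simp add: matrix_vector_mult_def greedy_matrix_def sum.cartesian_product split_beta' cong: if_cong)
  also have "\<dots> = (\<Sum>s'\<in>UNIV. \<gamma> * pmf (P s a) s' * d $ (s', g Q s'))"
    by (simp add: if_distrib[where f = "\<lambda>x. x * _"] cong: if_cong)
  finally show ?thesis
    by (simp add: sum_distrib_left mult.assoc)
qed

lemma discounted_matrix_greedy:
  assumes "0 \<le> \<gamma>" "\<gamma> < \<beta>"
  shows "discounted_matrix (greedy_matrix P \<gamma> g Q) \<gamma> \<beta>"
proof
  fix x y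
  show "0 \<le> greedy_matrix P \<gamma> g Q $ x $ y"
    using assms by (simp add: greedy_matrix_def case_prod_unfold)
  \<comment> \<open>Row sums are the values on the all-ones vector, where the transition
    probabilities add up to 1.\<close>
  have "(\<Sum>y\<in>UNIV. greedy_matrix P \<gamma> g Q $ x $ y) = (greedy_matrix P \<gamma> g Q *v 1) $ x"
    by (simp add: matrix_vector_mult_def)
  also have "\<dots> = \<gamma>"
    by (cases x) (simp add: greedy_matrix_mult_vec sum_pmf_eq_1)
  finally show "(\<Sum>y\<in>UNIV. greedy_matrix P \<gamma> g Q $ x $ y) \<le> \<gamma>" by simp
qed (use assms in simp)

theorem theorem2:
  fixes P :: "('s::finite, 'a::finite) kernel"
    and r :: "('s, 'a) reward"
    and \<gamma> \<epsilon> :: real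
    and \<pi>opt :: "'s \<Rightarrow> 'a"
    and g :: "('s, 'a) qvec \<Rightarrow> 's \<Rightarrow> 'a"
    and Qopt Q0 w v :: "('s, 'a) qvec"
  assumes reward_bound: "\<And>s a s'. \<bar>r s a s'\<bar> \<le> 1"
    and discount: "0 \<le> \<gamma>" "\<gamma> < 1"
    and optimal: "optimal_policy P r \<gamma> \<pi>opt"
    and Qopt: "Qopt = Q_policy P r \<gamma> \<pi>opt"
    and greedy: "greedy_selection g"
    and eps: "0 < \<epsilon>" "\<gamma> + \<epsilon> \<in> {0<..<1}"
    and w_pos: "\<And>x. 0 < w $ x"
    and v: "v = transpose (\<Sum>i. (1 / (\<gamma> + \<epsilon>)) ^ i *\<^sub>R matrix_power (greedy_matrix P \<gamma> g Qopt) i) *v w"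
    and init: "Q0 - Qopt \<le> 0"
  shows "\<forall>k. (\<gamma> + \<epsilon>) * (v \<bullet> (Q_iter P r \<gamma> Q0 k - Qopt)) \<le> v \<bullet> (Q_iter P r \<gamma> Q0 (Suc k) - Qopt)
           \<and> v \<bullet> (Q_iter P r \<gamma> Q0 (Suc k) - Qopt) \<le> 0"
proof -
  let ?A = "greedy_matrix P \<gamma> g Qopt"
  let ?\<beta> = "\<gamma> + \<epsilon>"
  define d where "d k = Q_iter P r \<gamma> Q0 k - Qopt" for k
  interpret discounted_matrix ?A \<gamma> ?\<beta>
    using discount eps by (intro discounted_matrix_greedy) auto
  \<comment> \<open>Moving the transpose across the inner product lets the series act on the error
    vectors.\<close>
  have v_inner: "v \<bullet> z = w \<bullet> (neumann_sum *v z)" for z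
    unfolding v by (simp add: neumann_sum_def dot_lmul_matrix)
  have w_inner_nonneg: "0 \<le> w \<bullet> z" if "0 \<le> z" for z
    unfolding inner_vec_def inner_real_def
    using that less_imp_le[OF w_pos] by (intro sum_nonneg mult_nonneg_nonneg) (auto simp: less_eq_vec_def)
  have v_inner_nonneg: "0 \<le> v \<bullet> z" if "0 \<le> z" for z
    using that by (simp add: v_inner w_inner_nonneg neumann_sum_mult_nonneg)

  \<comment> \<open>The rewards cancel because \<open>Qopt\<close> is a fixed point of the
    iteration.\<close>
  have d_Suc: "d (Suc k) $ (s, a)
      = \<gamma> * (\<Sum>s'\<in>UNIV. pmf (P s a) s' * ((MAX a'. Q_iter P r \<gamma> Q0 k $ (s', a')) - (MAX a'. Qopt $ (s', a'))))" for k s a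
    using optimal_policy_Bellman[where r = r and s = s and a = a, OF reward_bound discount optimal]
    by (simp add: d_def Qopt right_diff_distrib sum_subtractf)
  have d_nonpos: "d k \<le> 0" for k
  proof (induction k)
    case 0
    then show ?case using init by (simp add: d_def)
  next
    case (Suc k)
    then have "Q_iter P r \<gamma> Q0 k $ y \<le> Qopt $ y" for y
      by (cases y) (simp add: d_def less_eq_vec_def)
    then have "(MAX a'. Q_iter P r \<gamma> Q0 k $ (s', a')) \<le> (MAX a'. Qopt $ (s', a'))" for s'
      by (intro Max.boundedI) (auto intro!: Max_ge_iff[THEN iffD2])
    then show ?case
      using discount
      by (auto simp: less_eq_vec_def d_Suc intro!: mult_nonneg_nonpos sum_nonpos)
  qed
  have A_le: "?A *v d k \<le> d (Suc k)" for k
    unfolding less_eq_vec_def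
  proof
    fix x :: "'s \<times> 'a"
    obtain s a where x: "x = (s, a)" by fastforce
    \<comment> \<open>The second maximum is attained at \<open>g Qopt s'\<close>; the first is only
      bounded below by its value there.\<close>
    have "d k $ (s', g Qopt s')
        \<le> (MAX a'. Q_iter P r \<gamma> Q0 k $ (s', a')) - (MAX a'. Qopt $ (s', a'))" for s'
      by (simp add: d_def greedy_selection_MAX[OF greedy, of Qopt])
    then show "(?A *v d k) $ x \<le> d (Suc k) $ x"
      using discount unfolding x greedy_matrix_mult_vec d_Suc
      by (intro mult_left_mono sum_mono) auto
  qed
  have "?\<beta> * (v \<bullet> d k) \<le> v \<bullet> d (Suc k)" for k
  proof -
    \<comment> \<open>The added nonnegative term is exactly the one produced by the lost zeroth term
      in \<open>neumann_sum_shift\<close>.\<close>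
    have "?\<beta> * (v \<bullet> d k) \<le> ?\<beta> * (v \<bullet> d k) + ?\<beta> * (w \<bullet> (- d k))"
      using w_inner_nonneg[of "- d k"] d_nonpos[of k] weight_pos
      by (simp add: less_eq_vec_def mult_nonneg_nonpos)
    also have "\<dots> = v \<bullet> (?A *v d k)"
      unfolding v_inner neumann_sum_shift by (simp add: inner_diff_right right_diff_distrib)
    also have "\<dots> \<le> v \<bullet> d (Suc k)"
      using v_inner_nonneg[of "d (Suc k) - ?A *v d k"] A_le[of k]
      by (simp add: less_eq_vec_def inner_diff_right)
    finally show ?thesis .
  qed
  moreover have "v \<bullet> d k \<le> 0" for k
    using v_inner_nonneg[of "- d k"] d_nonpos[of k] by (simp add: less_eq_vec_def)
  ultimately show ?thesis
    by (simp only: d_def) blast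
qed

end
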